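(* Let $A$ be a Boolean algebra with least element $\mathbb{O}$ and greatest element $\mathbb{E}$. There is a vector lattice $\mathcal{F}(A)$ with the principal projection property (PPP) with the following properties: (i) There is an injective lattice homomorphism $\varphi$ from $A$ into $\mathcal{F}(A)_{+}$ such that $\varphi(\mathbb{O})=0_{\mathcal{F}(A)}$, $\varphi(\mathbb{E})$ is a strong unit of $\mathcal{F}(A)$, and $\mathrm{span}\,\varphi(A)=\mathcal{F}(A)$. (ii) (With $\varphi$ as in (i).) If $F$ is an ordered vector space and $\psi:A\to F_{+}$ is a lattice homomorphism with $\psi(\mathbb{O})=0_{F}$, then $\mathrm{span}\,\psi(A)$ is a lattice in the order induced from $F$, and there is a vector lattice homomorphism $J_{\psi}$ from $\mathcal{F}(A)$ onto $\mathrm{span}\,\psi(A)$ such that $\psi=J_{\psi}\circ\varphi$. Moreover, $J_\psi$ is an injection if and only if $\psi$ is. (iii) $\mathcal{F}(A)$ is isomorphic (as a vector lattice) to the lattice of simple continuous functions on a compact Hausdorff totally disconnected space $K$ such that $A$ is isomorphic to the Boolean algebra of clopen subsets of $K$.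
   Context: All vector spaces are real. For an ordered vector space $E$ (the order being antisymmetric and compatible with the linear structure), $E_{+}=\{e\in E: e\ge 0_E\}$. A vector lattice is an ordered vector space in which every two elements $e,f$ have a supremum $e\vee f$ and an infimum $e\wedge f$. A vector lattice $E$ has the principal projection property (PPP) if $\sup_{n\in\mathbb{N}} (e\wedge nf)$ exists in $E$ for every $e,f\in E_{+}$. An element $e\in E_{+}$ is a strong unit of a vector lattice $E$ if for every $f\in E$ there is $\alpha\ge 0$ such that $|f|\le\alpha e$, where $|f|=f\vee(-f)$. A map $\psi$ from a Boolean algebra $A$ into $F_{+}$, for an ordered vector space $F$, is a lattice homomorphism if it preserves $\vee$ and $\wedge$, i.e. for all $a,b\in A$ the supremum and infimum of $\psi(a),\psi(b)$ in $F$ exist and equal $\psi(a\vee b)$ and $\psi(a\wedge b)$ respectively. A vector lattice homomorphism is a linear map between vector lattices that preserves the lattice operations; an isomorphism is a bijective homomorphism. A function $f:K\to\mathbb{R}$ is simple if it attains only finitely many values; simple continuous functions are ordered pointwise. A set is clopen if it is both closed and open. $K$ is totally disconnected if it contains no nonempty connected subsets other than singletons. *)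

theory Defs
  imports
    "HOL-Analysis.Analysis"
    "HOL-Library.Function_Algebras"
    "HOL-Library.Lub_Glb"
begin

instantiation "fun" :: (type, real_vector) real_vector
begin

definition scaleR_fun_def: "c *\<^sub>R f = (\<lambda>x. c *\<^sub>R f x)"

instance
  by standard (simp_all add: scaleR_fun_def fun_eq_iff algebra_simps)

end

lemma scaleR_fun_apply [simp]: "(c *\<^sub>R f) x = c *\<^sub>R f x"
  by (simp add: scaleR_fun_def)

instance "fun" :: (type, ordered_real_vector) ordered_real_vector
  by standard (auto simp: le_fun_def intro: scaleR_left_mono scaleR_right_mono)

text \<open>
  An ordered vector space is a type of class \<^class>\<open>ordered_real_vector\<close>, or a linear subspace \<open>E\<close>
  of such a type with the induced order.  Suprema and infima are always relative to the space
  under consideration: \<open>isLub E S s\<close> and \<open>isGlb E S s\<close> refer to bounds in \<open>E\<close> only, so they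
  need not agree with suprema and infima in a larger space.
\<close>

definition vector_lattice_on :: "'v::ordered_real_vector set \<Rightarrow> bool" where
  "vector_lattice_on E \<longleftrightarrow> subspace E \<and>
     (\<forall>x\<in>E. \<forall>y\<in>E. (\<exists>s. isLub E {x, y} s) \<and> (\<exists>i. isGlb E {x, y} i))"

definition ppp_on :: "'v::ordered_real_vector set \<Rightarrow> bool" where
  "ppp_on E \<longleftrightarrow>
     (\<forall>e\<in>E. \<forall>f\<in>E. 0 \<le> e \<longrightarrow> 0 \<le> f \<longrightarrow>
        (\<exists>s. isLub E {m. \<exists>n::nat. isGlb E {e, real n *\<^sub>R f} m} s))"

text \<open>Here \<open>m\<close> is the modulus of \<open>f\<close>.\<close>

definition strong_unit_on :: "'v::ordered_real_vector set \<Rightarrow> 'v \<Rightarrow> bool" where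
  "strong_unit_on E e \<longleftrightarrow> e \<in> E \<and> 0 \<le> e \<and>
     (\<forall>f\<in>E. \<exists>\<alpha>\<ge>0. \<exists>m. isLub E {f, - f} m \<and> m \<le> \<alpha> *\<^sub>R e)"

definition cone_lattice_hom ::
    "'v::ordered_real_vector set \<Rightarrow> ('a::boolean_algebra \<Rightarrow> 'v) \<Rightarrow> bool" where
  "cone_lattice_hom E \<psi> \<longleftrightarrow>
     (\<forall>a. \<psi> a \<in> E \<and> 0 \<le> \<psi> a) \<and>
     (\<forall>a b. isLub E {\<psi> a, \<psi> b} (\<psi> (sup a b)) \<and> isGlb E {\<psi> a, \<psi> b} (\<psi> (inf a b)))"

definition vector_lattice_hom_on ::
    "'v::ordered_real_vector set \<Rightarrow> 'w::ordered_real_vector set \<Rightarrow> ('v \<Rightarrow> 'w) \<Rightarrow> bool" where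
  "vector_lattice_hom_on E G J \<longleftrightarrow>
     (\<forall>x\<in>E. J x \<in> G) \<and>
     (\<forall>x\<in>E. \<forall>y\<in>E. J (x + y) = J x + J y) \<and>
     (\<forall>c. \<forall>x\<in>E. J (c *\<^sub>R x) = c *\<^sub>R J x) \<and>
     (\<forall>x\<in>E. \<forall>y\<in>E. \<forall>s. isLub E {x, y} s \<longrightarrow> isLub G {J x, J y} (J s)) \<and>
     (\<forall>x\<in>E. \<forall>y\<in>E. \<forall>i. isGlb E {x, y} i \<longrightarrow> isGlb G {J x, J y} (J i))"

definition vector_lattice_isomorphic ::
    "'v::ordered_real_vector set \<Rightarrow> 'w::ordered_real_vector set \<Rightarrow> bool" where
  "vector_lattice_isomorphic E G \<longleftrightarrow> (\<exists>J. vector_lattice_hom_on E G J \<and> bij_betw J E G)"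

definition generates_vector_lattice ::
    "'v::ordered_real_vector set \<Rightarrow> ('a::boolean_algebra \<Rightarrow> 'v) \<Rightarrow> bool" where
  "generates_vector_lattice E \<phi> \<longleftrightarrow>
     inj \<phi> \<and> cone_lattice_hom E \<phi> \<and> \<phi> bot = 0 \<and> strong_unit_on E (\<phi> top) \<and>
     span (range \<phi>) = E"

definition totally_disconnected_space :: "'k topology \<Rightarrow> bool" where
  "totally_disconnected_space K \<longleftrightarrow>
     (\<forall>C. connectedin K C \<longrightarrow> C = {} \<or> (\<exists>x. C = {x}))"

text \<open>
  Functions on \<open>topspace K\<close> are represented by total functions vanishing off \<open>topspace K\<close>;
  for these the order of the function type is the pointwise order on \<open>topspace K\<close>.
\<close>

definition simple_continuous :: "'k topology \<Rightarrow> ('k \<Rightarrow> real) set" where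
  "simple_continuous K =
     {f. continuous_map K euclideanreal f \<and> finite (f ` topspace K) \<and>
         (\<forall>x. x \<notin> topspace K \<longrightarrow> f x = 0)}"

definition clopen_sets :: "'k topology \<Rightarrow> 'k set set" where
  "clopen_sets K = {U. openin K U \<and> closedin K U}"

definition isomorphic_to_clopen_algebra ::
    "'a::boolean_algebra itself \<Rightarrow> 'k topology \<Rightarrow> bool" where
  "isomorphic_to_clopen_algebra A K \<longleftrightarrow>
     (\<exists>\<theta> :: 'a \<Rightarrow> 'k set. bij_betw \<theta> UNIV (clopen_sets K) \<and>
        \<theta> bot = {} \<and> \<theta> top = topspace K \<and>
        (\<forall>a b. \<theta> (sup a b) = \<theta> a \<union> \<theta> b \<and> \<theta> (inf a b) = \<theta> a \<inter> \<theta> b) \<and>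
        (\<forall>a. \<theta> (- a) = topspace K - \<theta> a))"

end

theory Submission
  imports Defs
begin

text \<open>
  The lattice \<open>\<F>(A)\<close> is the space of simple continuous functions on the Stone space of \<open>A\<close>,
  whose points are the ultrafilters of \<open>A\<close> and whose clopen sets are exactly the sets
  \<open>stone_set a\<close> of ultrafilters containing an element \<open>a\<close> (\<open>clopen_sets_stone_space\<close>).  The
  embedding sends \<open>a\<close> to the indicator of \<open>stone_set a\<close>.  Everything that is claimed about this
  space by itself is elementary: simple functions are combined pointwise, and since such a function
  stays away from zero on its support, the increasing sequence \<open>inf e (n f)\<close> in the principal
  projection property is eventually constant.

  The universal property is an integration argument.  Let \<open>\<psi>\<close> be a lattice homomorphism from \<open>A\<close>
  into an ordered vector space with \<open>\<psi> bot = 0\<close>.  Because \<open>x + y = sup x y + inf x y\<close> whenever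
  the right-hand side exists, \<open>\<psi>\<close> is additive on disjoint elements
  (\<open>disjoint_charge_of_cone_lattice_hom\<close>).  It is thus a finitely additive vector-valued measure on
  the clopen sets, and integration against it is a positive linear map from the simple functions
  onto the span of the image of \<open>\<psi>\<close>.

  The point is that integration preserves suprema although the span is not known to be a lattice.
  If \<open>p, q \<ge> 0\<close> have disjoint supports \<open>U\<close> and \<open>V\<close>, then a lower bound of their integrals is a
  lower bound of \<open>C \<psi>(U)\<close> and \<open>C \<psi>(V)\<close> for a constant \<open>C > 0\<close>, hence is at most \<open>0\<close>
  (\<open>charge_integral_disjoint\<close>).  Applying this to \<open>sup f g - f\<close> and \<open>sup f g - g\<close> shows that the
  integral of \<open>sup f g\<close> is the least upper bound of the integrals of \<open>f\<close> and \<open>g\<close>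
  (\<open>isLub_charge_integral_sup\<close>), and infima are dual.  So the span is a lattice and the integral a
  lattice homomorphism; its kernel is trivial precisely if \<open>\<psi>\<close> is injective.

  Any lattice \<open>E\<close> generated by a copy \<open>\<phi>(A)\<close> of \<open>A\<close> is an instance of this with an injective
  homomorphism, so it is isomorphic to the space of simple functions and inherits the universal
  property (\<open>generated_vector_lattice_universal\<close>).
\<close>

section \<open>Bounds and homomorphisms relative to a subspace\<close>

lemma isLub_pair_iff:
  "isLub E {x, y} s \<longleftrightarrow> s \<in> E \<and> x \<le> s \<and> y \<le> s \<and> (\<forall>z\<in>E. x \<le> z \<longrightarrow> y \<le> z \<longrightarrow> s \<le> z)"
  by (auto simp: isLub_def leastP_def isUb_def setle_def setge_def)

lemma isGlb_pair_iff:
  "isGlb E {x, y} s \<longleftrightarrow> s \<in> E \<and> s \<le> x \<and> s \<le> y \<and> (\<forall>z\<in>E. z \<le> x \<longrightarrow> z \<le> y \<longrightarrow> z \<le> s)"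
  by (auto simp: isGlb_def greatestP_def isLb_def setle_def setge_def)

lemma isLub_pair_unique:
  fixes s t :: "'v::order"
  shows "isLub E {x, y} s \<Longrightarrow> isLub E {x, y} t \<Longrightarrow> s = t"
  unfolding isLub_pair_iff by (meson antisym)

lemma isGlb_pair_unique:
  fixes s t :: "'v::order"
  shows "isGlb E {x, y} s \<Longrightarrow> isGlb E {x, y} t \<Longrightarrow> s = t"
  unfolding isGlb_pair_iff by (meson antisym)

lemma isLub_pair_subset: "isLub G {x, y} s \<Longrightarrow> E \<subseteq> G \<Longrightarrow> s \<in> E \<Longrightarrow> isLub E {x, y} s"
  by (auto simp: isLub_pair_iff)

lemma isGlb_pair_subset: "isGlb G {x, y} s \<Longrightarrow> E \<subseteq> G \<Longrightarrow> s \<in> E \<Longrightarrow> isGlb E {x, y} s"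
  by (auto simp: isGlb_pair_iff)

text \<open>
  The identity \<open>x + y = x \<squnion> y + x \<sqinter> y\<close> in the disjoint case: the reflection \<open>z \<mapsto> x + y - z\<close> swaps
  upper bounds with lower bounds of the pair.
\<close>

lemma isLub_eq_add_of_disjoint:
  fixes x y s :: "'v::ordered_real_vector"
  assumes "subspace G" "x \<in> G" "y \<in> G" "isLub G {x, y} s" "isGlb G {x, y} 0"
  shows "s = x + y"
proof (rule antisym)
  have s: "s \<in> G" "x \<le> s" "y \<le> s" "\<And>z. z \<in> G \<Longrightarrow> x \<le> z \<Longrightarrow> y \<le> z \<Longrightarrow> s \<le> z"
    using assms(4) by (auto simp: isLub_pair_iff)
  have i: "0 \<le> x" "0 \<le> y" "\<And>z. z \<in> G \<Longrightarrow> z \<le> x \<Longrightarrow> z \<le> y \<Longrightarrow> z \<le> 0"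
    using assms(5) by (auto simp: isGlb_pair_iff)
  show "s \<le> x + y"
    using i assms by (intro s) (auto intro: subspace_add)
  have "x + y - s \<le> 0"
    using s assms by (intro i) (auto intro!: subspace_add subspace_diff simp: algebra_simps)
  then show "x + y \<le> s" by simp
qed

lemma vector_lattice_hom_on_id: "vector_lattice_hom_on E E id"
  by (simp add: vector_lattice_hom_on_def)

lemma vector_lattice_hom_on_comp:
  assumes "vector_lattice_hom_on E G I" "vector_lattice_hom_on G H J"
  shows "vector_lattice_hom_on E H (J \<circ> I)"
  using assms unfolding vector_lattice_hom_on_def by simp

text \<open>
  A supremum in \<open>G\<close> of two images \<open>J x\<close>, \<open>J y\<close> is the image of the supremum of \<open>x\<close> and \<open>y\<close> because
  the latter exists and suprema are unique.
\<close>

lemma vector_lattice_hom_on_inverse: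
  fixes J :: "'v::ordered_real_vector \<Rightarrow> 'w::ordered_real_vector"
  assumes E: "vector_lattice_on E" and J: "vector_lattice_hom_on E G J" and bij: "bij_betw J E G"
  shows "vector_lattice_hom_on G E (the_inv_into E J)"
  unfolding vector_lattice_hom_on_def
proof (intro conjI ballI allI impI)
  let ?I = "the_inv_into E J"
  have IJ: "?I (J e) = e" if "e \<in> E" for e
    using bij that by (simp add: bij_betw_def the_inv_into_f_f)
  have sub: "subspace E" using E by (simp add: vector_lattice_on_def)
  fix x assume "x \<in> G"
  then obtain e where e: "e \<in> E" "x = J e" using bij by (auto simp: bij_betw_def)
  show "?I x \<in> E" using e by (simp add: IJ)
  have "c *\<^sub>R x = J (c *\<^sub>R e)" for c
    using J e by (simp add: vector_lattice_hom_on_def)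
  then show "?I (c *\<^sub>R x) = c *\<^sub>R ?I x" for c
    using e sub by (simp add: IJ subspace_scale)
  fix y assume "y \<in> G"
  then obtain f where f: "f \<in> E" "y = J f" using bij by (auto simp: bij_betw_def)
  have "x + y = J (e + f)"
    using J e f by (simp add: vector_lattice_hom_on_def)
  then show "?I (x + y) = ?I x + ?I y"
    using e f sub by (simp add: IJ subspace_add)
  fix s
  show "isLub E {?I x, ?I y} (?I s)" if s: "isLub G {x, y} s"
  proof -
    obtain t where t: "isLub E {e, f} t"
      using E e(1) f(1) unfolding vector_lattice_on_def by blast
    then have "isLub G {x, y} (J t)"
      using J e f by (simp add: vector_lattice_hom_on_def)
    then have "s = J t" using s by (rule isLub_pair_unique[rotated])
    moreover have "t \<in> E" using t by (simp add: isLub_pair_iff)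
    ultimately show ?thesis using t e f by (simp add: IJ)
  qed
  show "isGlb E {?I x, ?I y} (?I s)" if s: "isGlb G {x, y} s"
  proof -
    obtain t where t: "isGlb E {e, f} t"
      using E e(1) f(1) unfolding vector_lattice_on_def by blast
    then have "isGlb G {x, y} (J t)"
      using J e f by (simp add: vector_lattice_hom_on_def)
    then have "s = J t" using s by (rule isGlb_pair_unique[rotated])
    moreover have "t \<in> E" using t by (simp add: isGlb_pair_iff)
    ultimately show ?thesis using t e f by (simp add: IJ)
  qed
qed

lemma vector_lattice_hom_on_image:
  assumes "vector_lattice_on E" "vector_lattice_hom_on E G J" "J ` E = G" "subspace G"
  shows "vector_lattice_on G"
  unfolding vector_lattice_on_def
proof (intro conjI ballI)
  fix x y assume "x \<in> G" "y \<in> G"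
  then obtain e f where ef: "e \<in> E" "f \<in> E" "x = J e" "y = J f"
    using assms(3) by blast
  then obtain s i where "isLub E {e, f} s" "isGlb E {e, f} i"
    using assms(1) unfolding vector_lattice_on_def by blast
  then have "isLub G {x, y} (J s)" "isGlb G {x, y} (J i)"
    using assms(2) ef by (simp_all add: vector_lattice_hom_on_def)
  then show "\<exists>s. isLub G {x, y} s" "\<exists>i. isGlb G {x, y} i" by blast+
qed (fact assms(4))

section \<open>Functions with finitely many values and clopen fibres\<close>

definition fiber :: "'k topology \<Rightarrow> ('k \<Rightarrow> 'b) \<Rightarrow> 'b \<Rightarrow> 'k set" where
  "fiber K h y = {x \<in> topspace K. h x = y}"

text \<open>
  Values of arbitrary type are allowed so that a pair of functions is again such a map; every
  operation on functions is then a composition with a map on the values.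
\<close>

definition simple_map :: "'k topology \<Rightarrow> ('k \<Rightarrow> 'b) \<Rightarrow> bool" where
  "simple_map K h \<longleftrightarrow> finite (h ` topspace K) \<and> (\<forall>y. fiber K h y \<in> clopen_sets K)"

lemma clopen_sets_Un: "U \<in> clopen_sets K \<Longrightarrow> V \<in> clopen_sets K \<Longrightarrow> U \<union> V \<in> clopen_sets K"
  and clopen_sets_Int: "U \<in> clopen_sets K \<Longrightarrow> V \<in> clopen_sets K \<Longrightarrow> U \<inter> V \<in> clopen_sets K"
  and clopen_sets_Diff: "U \<in> clopen_sets K \<Longrightarrow> V \<in> clopen_sets K \<Longrightarrow> U - V \<in> clopen_sets K"
  and clopen_sets_empty: "{} \<in> clopen_sets K"
  and clopen_sets_topspace: "topspace K \<in> clopen_sets K"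
  by (auto simp: clopen_sets_def)

lemma clopen_sets_subset: "U \<in> clopen_sets K \<Longrightarrow> U \<subseteq> topspace K"
  by (auto simp: clopen_sets_def dest: openin_subset)

lemma clopen_sets_UN:
  "finite I \<Longrightarrow> (\<And>i. i \<in> I \<Longrightarrow> A i \<in> clopen_sets K) \<Longrightarrow> (\<Union>i\<in>I. A i) \<in> clopen_sets K"
  by (induction I rule: finite_induct) (auto intro: clopen_sets_Un clopen_sets_empty)

lemma simple_map_preimage:
  assumes "simple_map K h"
  shows "{x \<in> topspace K. P (h x)} \<in> clopen_sets K"
proof -
  have "{x \<in> topspace K. P (h x)} = (\<Union>y\<in>h ` topspace K \<inter> Collect P. fiber K h y)"
    by (auto simp: fiber_def)
  also have "\<dots> \<in> clopen_sets K"
    using assms by (intro clopen_sets_UN) (auto simp: simple_map_def)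
  finally show ?thesis .
qed

lemma simple_map_comp:
  assumes "simple_map K h" and f: "\<And>x. x \<in> topspace K \<Longrightarrow> f x = u (h x)"
  shows "simple_map K f"
proof -
  have "f ` topspace K = u ` h ` topspace K"
    using f by (auto simp: image_iff)
  moreover have "fiber K f r \<in> clopen_sets K" for r
  proof -
    have "fiber K f r = {x \<in> topspace K. u (h x) = r}"
      using f by (auto simp: fiber_def)
    then show ?thesis using simple_map_preimage[OF assms(1), of "\<lambda>y. u y = r"] by simp
  qed
  ultimately show ?thesis using assms(1) by (simp add: simple_map_def)
qed

lemma simple_map_Pair:
  assumes "simple_map K f" "simple_map K g"
  shows "simple_map K (\<lambda>x. (f x, g x))"
proof -
  have "(\<lambda>x. (f x, g x)) ` topspace K \<subseteq> f ` topspace K \<times> g ` topspace K"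
    by auto
  moreover have "fiber K (\<lambda>x. (f x, g x)) y = fiber K f (fst y) \<inter> fiber K g (snd y)" for y
    by (auto simp: fiber_def)
  ultimately show ?thesis
    using assms unfolding simple_map_def
    by (metis clopen_sets_Int finite_SigmaI finite_subset)
qed

text \<open>
  If a continuous function attains only finitely many values, then the complement of a fibre is a
  preimage of a finite, hence closed, set; so fibres are open as well as closed.
\<close>

lemma simple_continuous_iff:
  "f \<in> simple_continuous K \<longleftrightarrow> simple_map K f \<and> (\<forall>x. x \<notin> topspace K \<longrightarrow> f x = 0)"
proof -
  have "simple_map K f"
    if c: "continuous_map K euclideanreal f" and fin: "finite (f ` topspace K)"
  proof -
    have "fiber K f r \<in> clopen_sets K" for r
    proof -
      have "closedin K {x \<in> topspace K. f x \<in> {r}}"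
        by (intro closedin_continuous_map_preimage[OF c]) auto
      moreover have "closedin K {x \<in> topspace K. f x \<in> f ` topspace K - {r}}"
        using fin by (intro closedin_continuous_map_preimage[OF c]) (auto intro: finite_imp_closed)
      then have "openin K (topspace K - {x \<in> topspace K. f x \<in> f ` topspace K - {r}})"
        by blast
      moreover have "topspace K - {x \<in> topspace K. f x \<in> f ` topspace K - {r}} = fiber K f r"
        by (auto simp: fiber_def)
      moreover have "{x \<in> topspace K. f x \<in> {r}} = fiber K f r"
        by (auto simp: fiber_def)
      ultimately show ?thesis by (simp add: clopen_sets_def)
    qed
    with fin show ?thesis by (simp add: simple_map_def)
  qed
  moreover have "continuous_map K euclideanreal f" if "simple_map K f"
    using simple_map_preimage[OF that, of "\<lambda>r. r \<in> V" for V]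
    by (auto simp: continuous_map_def clopen_sets_def)
  ultimately show ?thesis
    by (auto simp: simple_continuous_def simple_map_def)
qed

lemma simple_continuous_simple_map: "f \<in> simple_continuous K \<Longrightarrow> simple_map K f"
  by (simp add: simple_continuous_iff)

lemma simple_continuous_comp2:
  assumes "f \<in> simple_continuous K" "g \<in> simple_continuous K"
    and "\<And>x. k x = u (f x) (g x)" and "u 0 0 = 0"
  shows "k \<in> simple_continuous K"
proof -
  have "simple_map K k"
    using assms by (intro simple_map_comp[OF simple_map_Pair[of K f g], of k "\<lambda>(a, b). u a b"])
      (auto simp: simple_continuous_iff)
  then show ?thesis using assms by (auto simp: simple_continuous_iff)
qed

lemma simple_continuous_add:
  "f \<in> simple_continuous K \<Longrightarrow> g \<in> simple_continuous K \<Longrightarrow> f + g \<in> simple_continuous K"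
  by (rule simple_continuous_comp2[where u = "(+)"]) auto

lemma simple_continuous_diff:
  "f \<in> simple_continuous K \<Longrightarrow> g \<in> simple_continuous K \<Longrightarrow> f - g \<in> simple_continuous K"
  by (rule simple_continuous_comp2[where u = "(-)"]) auto

lemma simple_continuous_scaleR: "f \<in> simple_continuous K \<Longrightarrow> c *\<^sub>R f \<in> simple_continuous K"
  by (rule simple_continuous_comp2[where f = f and g = f and u = "\<lambda>a b. c * a"]) auto

lemma simple_continuous_sup:
  "f \<in> simple_continuous K \<Longrightarrow> g \<in> simple_continuous K \<Longrightarrow> sup f g \<in> simple_continuous K"
  by (rule simple_continuous_comp2[where u = sup]) auto

lemma simple_continuous_inf:
  "f \<in> simple_continuous K \<Longrightarrow> g \<in> simple_continuous K \<Longrightarrow> inf f g \<in> simple_continuous K"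
  by (rule simple_continuous_comp2[where u = inf]) auto

lemma simple_continuous_indicator:
  assumes "U \<in> clopen_sets K"
  shows "(indicator U :: 'k \<Rightarrow> real) \<in> simple_continuous K"
proof -
  have "fiber K (indicator U :: 'k \<Rightarrow> real) r =
      (if r = 1 then U else if r = 0 then topspace K - U else {})" for r
    using clopen_sets_subset[OF assms] by (auto simp: fiber_def indicator_def)
  moreover have "finite ((indicator U :: 'k \<Rightarrow> real) ` topspace K)"
    by (rule finite_subset[of _ "{0, 1}"]) (auto simp: indicator_def)
  ultimately have "simple_map K (indicator U :: 'k \<Rightarrow> real)"
    using assms by (auto simp: simple_map_def clopen_sets_Diff clopen_sets_topspace clopen_sets_empty)
  then show ?thesis
    using clopen_sets_subset[OF assms] by (auto simp: simple_continuous_iff indicator_def)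
qed

lemma subspace_simple_continuous: "subspace (simple_continuous (K :: 'k topology))"
proof -
  have "(0 :: 'k \<Rightarrow> real) = indicator {}" by auto
  then have "(0 :: 'k \<Rightarrow> real) \<in> simple_continuous K"
    using simple_continuous_indicator[OF clopen_sets_empty, of K] by simp
  then show ?thesis
    by (auto simp: subspace_def intro: simple_continuous_add simple_continuous_scaleR)
qed

lemma simple_continuous_bounded:
  assumes "f \<in> simple_continuous K"
  obtains C where "C > 0" "\<And>x. \<bar>f x\<bar> \<le> C"
proof -
  have "finite ((\<lambda>x. \<bar>f x\<bar>) ` topspace K)"
    using finite_imageI[of "f ` topspace K" abs] assms
    by (simp add: simple_continuous_iff simple_map_def image_image)
  then have "bdd_above ((\<lambda>x. \<bar>f x\<bar>) ` topspace K)"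
    by (rule bdd_above_finite)
  then obtain B where B: "\<And>x. x \<in> topspace K \<Longrightarrow> \<bar>f x\<bar> \<le> B"
    by (auto simp: bdd_above_def)
  have "\<bar>f x\<bar> \<le> max B 1" for x
  proof (cases "x \<in> topspace K")
    case True
    then show ?thesis by (rule order_trans[OF B]) simp
  next
    case False
    then show ?thesis using assms by (simp add: simple_continuous_iff le_max_iff_disj)
  qed
  then show ?thesis by (intro that[of "max B 1"]) auto
qed

lemma simple_continuous_sum_fibers:
  assumes "f \<in> simple_continuous K"
  shows "f = (\<Sum>r\<in>f ` topspace K. r *\<^sub>R indicator (fiber K f r))"
proof
  fix x
  have fin: "finite (f ` topspace K)"
    using assms by (simp add: simple_continuous_iff simple_map_def)
  have sum_app: "(\<Sum>r\<in>R. F r) x = (\<Sum>r\<in>R. F r x)" if "finite R"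
    for R :: "real set" and F :: "real \<Rightarrow> 'a \<Rightarrow> real"
    using that by (induction R rule: finite_induct) auto
  have "(\<Sum>r\<in>f ` topspace K. r *\<^sub>R indicator (fiber K f r)) x =
      (\<Sum>r\<in>f ` topspace K. if r = f x then (if x \<in> topspace K then r else 0) else 0)"
    unfolding sum_app[OF fin] by (rule sum.cong) (auto simp: fiber_def indicator_def)
  also have "\<dots> = f x"
    using fin assms by (auto simp: simple_continuous_iff)
  finally show "f x = (\<Sum>r\<in>f ` topspace K. r *\<^sub>R indicator (fiber K f r)) x" by simp
qed

lemma isLub_simple_continuous_sup:
  "f \<in> simple_continuous K \<Longrightarrow> g \<in> simple_continuous K \<Longrightarrow> isLub (simple_continuous K) {f, g} (sup f g)"
  by (auto simp: isLub_pair_iff simple_continuous_sup)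

lemma isGlb_simple_continuous_inf:
  "f \<in> simple_continuous K \<Longrightarrow> g \<in> simple_continuous K \<Longrightarrow> isGlb (simple_continuous K) {f, g} (inf f g)"
  by (auto simp: isGlb_pair_iff simple_continuous_inf)

lemma vector_lattice_simple_continuous: "vector_lattice_on (simple_continuous K)"
  unfolding vector_lattice_on_def
  using subspace_simple_continuous isLub_simple_continuous_sup isGlb_simple_continuous_inf by blast

text \<open>
  Where \<open>f\<close> is nonzero it is bounded below by its least positive value, hence \<open>inf e (n f)\<close>
  is the same function for all large \<open>n\<close>: the supremum is attained.
\<close>

lemma ppp_simple_continuous: "ppp_on (simple_continuous K)"
  unfolding ppp_on_def
proof (intro ballI impI)
  let ?S = "simple_continuous K"
  fix e f :: "'a \<Rightarrow> real"
  assume e: "e \<in> ?S" "0 \<le> e" and f: "f \<in> ?S" "0 \<le> f"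
  have "(\<lambda>x. e x / f x) \<in> ?S"
    by (rule simple_continuous_comp2[OF e(1) f(1), where u = "(/)"]) auto
  then obtain C where C: "\<And>x. \<bar>e x / f x\<bar> \<le> C"
    by (rule simple_continuous_bounded) auto
  obtain N :: nat where N: "C \<le> real N"
    using real_arch_simple by blast
  have large: "e x \<le> real N * f x" if "f x \<noteq> 0" for x
  proof -
    have "0 < f x" using that f(2) by (simp add: le_fun_def less_le)
    moreover have "e x / f x \<le> real N" using C[of x] N by linarith
    ultimately show ?thesis by (simp add: divide_le_eq)
  qed
  let ?M = "{m. \<exists>n::nat. isGlb ?S {e, real n *\<^sub>R f} m}"
  have Glb: "isGlb ?S {e, real n *\<^sub>R f} (inf e (real n *\<^sub>R f))" for n
    by (intro isGlb_simple_continuous_inf e f simple_continuous_scaleR)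
  have ub: "inf e (real n *\<^sub>R f) \<le> inf e (real N *\<^sub>R f)" for n
  proof (rule le_funI)
    fix x
    show "inf e (real n *\<^sub>R f) x \<le> inf e (real N *\<^sub>R f) x"
      using large[of x] e(2) by (cases "f x = 0") (auto simp: le_fun_def inf_real_def)
  qed
  have "?M = range (\<lambda>n. inf e (real n *\<^sub>R f))"
    using Glb isGlb_pair_unique by blast
  moreover have "isLub ?S (range (\<lambda>n. inf e (real n *\<^sub>R f))) (inf e (real N *\<^sub>R f))"
    using ub Glb[of N] by (auto simp: isLub_def leastP_def isUb_def setle_def setge_def isGlb_pair_iff)
  ultimately show "\<exists>s. isLub ?S ?M s" by metis
qed

lemma strong_unit_simple_continuous:
  "strong_unit_on (simple_continuous K) (indicator (topspace K))"
  unfolding strong_unit_on_def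
proof (intro conjI ballI)
  show "indicator (topspace K) \<in> simple_continuous K"
    by (intro simple_continuous_indicator clopen_sets_topspace)
  show "0 \<le> (indicator (topspace K) :: 'a \<Rightarrow> real)"
    by (simp add: le_fun_def)
  fix f assume f: "f \<in> simple_continuous K"
  then obtain C where C: "C > 0" "\<And>x. \<bar>f x\<bar> \<le> C"
    by (rule simple_continuous_bounded) auto
  have "- f \<in> simple_continuous K"
    using f subspace_simple_continuous by (rule subspace_neg[rotated])
  then have "isLub (simple_continuous K) {f, - f} (sup f (- f))"
    using f by (intro isLub_simple_continuous_sup)
  moreover have "sup f (- f) \<le> C *\<^sub>R indicator (topspace K)"
  proof (rule le_funI)
    fix x
    show "sup f (- f) x \<le> (C *\<^sub>R indicator (topspace K)) x"
      using C(2)[of x] f by (cases "x \<in> topspace K") (auto simp: simple_continuous_iff sup_real_def)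
  qed
  ultimately show "\<exists>\<alpha>\<ge>0. \<exists>m. isLub (simple_continuous K) {f, - f} m \<and> m \<le> \<alpha> *\<^sub>R indicator (topspace K)"
    using C(1) by (intro exI[of _ C]) auto
qed

lemma span_clopen_indicators:
  "span (indicator ` clopen_sets K) = simple_continuous K"
proof
  show "span (indicator ` clopen_sets K) \<subseteq> simple_continuous K"
    by (intro span_minimal subspace_simple_continuous) (auto intro: simple_continuous_indicator)
  show "simple_continuous K \<subseteq> span (indicator ` clopen_sets K)"
  proof
    fix f assume f: "f \<in> simple_continuous K"
    have "(\<Sum>r\<in>f ` topspace K. r *\<^sub>R indicator (fiber K f r)) \<in> span (indicator ` clopen_sets K)"
      using f by (intro span_sum span_scale span_base)
        (auto simp: simple_continuous_iff simple_map_def)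
    then show "f \<in> span (indicator ` clopen_sets K)"
      by (metis f simple_continuous_sum_fibers)
  qed
qed

section \<open>Integration against a disjointness preserving charge\<close>

text \<open>
  A finitely additive measure on the clopen sets with values in an ordered vector space \<open>G\<close> that
  need not be a lattice.  That pairs of integrals have suprema and infima in \<open>G\<close> is a conclusion,
  drawn from the one lattice operation assumed: disjoint sets have charges with infimum \<open>0\<close>.
\<close>

locale disjoint_charge =
  fixes K :: "'k topology" and G :: "'v::ordered_real_vector set" and \<mu> :: "'k set \<Rightarrow> 'v"
  assumes subspace: "subspace G"
    and charge_mem: "U \<in> clopen_sets K \<Longrightarrow> \<mu> U \<in> G"
    and charge_nonneg: "U \<in> clopen_sets K \<Longrightarrow> 0 \<le> \<mu> U"
    and charge_Un: "U \<in> clopen_sets K \<Longrightarrow> V \<in> clopen_sets K \<Longrightarrow> U \<inter> V = {} \<Longrightarrow> \<mu> (U \<union> V) = \<mu> U + \<mu> V"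
    and charge_disjoint: "U \<in> clopen_sets K \<Longrightarrow> V \<in> clopen_sets K \<Longrightarrow> U \<inter> V = {} \<Longrightarrow> isGlb G {\<mu> U, \<mu> V} 0"
begin

definition charge_integral :: "('k \<Rightarrow> real) \<Rightarrow> 'v" where
  "charge_integral f = (\<Sum>r\<in>f ` topspace K. r *\<^sub>R \<mu> (fiber K f r))"

lemma charge_empty: "\<mu> {} = 0"
  using charge_Un[of "{}" "{}"] clopen_sets_empty[of K] by simp

lemma charge_UN:
  assumes "finite I" "\<And>i. i \<in> I \<Longrightarrow> A i \<in> clopen_sets K"
    and "\<And>i j. i \<in> I \<Longrightarrow> j \<in> I \<Longrightarrow> i \<noteq> j \<Longrightarrow> A i \<inter> A j = {}"
  shows "\<mu> (\<Union>i\<in>I. A i) = (\<Sum>i\<in>I. \<mu> (A i))"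
  using assms
proof (induction I rule: finite_induct)
  case empty
  then show ?case by (simp add: charge_empty)
next
  case (insert i I)
  have "A i \<inter> (\<Union>j\<in>I. A j) = {}"
    using insert.prems(2)[of i] insert.hyps(2) by blast
  then have "\<mu> (A i \<union> (\<Union>j\<in>I. A j)) = \<mu> (A i) + \<mu> (\<Union>j\<in>I. A j)"
    using insert by (intro charge_Un clopen_sets_UN) auto
  then show ?case using insert by simp
qed

text \<open>
  The sum may be taken over the fibres of any finer map instead of the fibres of \<open>f\<close>.  Applied
  to the pair of two functions, which is finer than both, this yields additivity.
\<close>

lemma charge_integral_comp:
  assumes h: "simple_map K h" and f: "\<And>x. x \<in> topspace K \<Longrightarrow> f x = u (h x)"
  shows "charge_integral f = (\<Sum>y\<in>h ` topspace K. u y *\<^sub>R \<mu> (fiber K h y))"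
proof -
  let ?H = "h ` topspace K"
  have fin: "finite ?H" using h by (simp add: simple_map_def)
  have img: "f ` topspace K = u ` ?H"
    using f by (auto simp: image_iff)
  have "\<mu> (fiber K f r) = (\<Sum>y\<in>{y \<in> ?H. u y = r}. \<mu> (fiber K h y))" for r
  proof -
    have "fiber K f r = (\<Union>y\<in>{y \<in> ?H. u y = r}. fiber K h y)"
      using f by (auto simp: fiber_def)
    also have "\<mu> \<dots> = (\<Sum>y\<in>{y \<in> ?H. u y = r}. \<mu> (fiber K h y))"
      using h fin by (intro charge_UN) (auto simp: fiber_def simple_map_def)
    finally show ?thesis .
  qed
  then have "charge_integral f = (\<Sum>r\<in>u ` ?H. \<Sum>y\<in>{y \<in> ?H. u y = r}. u y *\<^sub>R \<mu> (fiber K h y))"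
    unfolding charge_integral_def img by (auto simp: scaleR_sum_right intro!: sum.cong)
  also have "\<dots> = (\<Sum>y\<in>?H. u y *\<^sub>R \<mu> (fiber K h y))"
    by (rule sum.image_gen[OF fin, symmetric])
  finally show ?thesis .
qed

lemma charge_integral_add:
  assumes "f \<in> simple_continuous K" "g \<in> simple_continuous K"
  shows "charge_integral (f + g) = charge_integral f + charge_integral g"
proof -
  have h: "simple_map K (\<lambda>x. (f x, g x))"
    using assms by (intro simple_map_Pair simple_continuous_simple_map)
  have "charge_integral f = (\<Sum>y\<in>(\<lambda>x. (f x, g x)) ` topspace K. fst y *\<^sub>R \<mu> (fiber K (\<lambda>x. (f x, g x)) y))"
    "charge_integral g = (\<Sum>y\<in>(\<lambda>x. (f x, g x)) ` topspace K. snd y *\<^sub>R \<mu> (fiber K (\<lambda>x. (f x, g x)) y))"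
    "charge_integral (f + g) =
      (\<Sum>y\<in>(\<lambda>x. (f x, g x)) ` topspace K. (fst y + snd y) *\<^sub>R \<mu> (fiber K (\<lambda>x. (f x, g x)) y))"
    by (intro charge_integral_comp[OF h]; simp)+
  then show ?thesis by (simp add: scaleR_add_left sum.distrib)
qed

lemma charge_integral_scaleR:
  assumes "f \<in> simple_continuous K"
  shows "charge_integral (c *\<^sub>R f) = c *\<^sub>R charge_integral f"
proof -
  have "charge_integral (c *\<^sub>R f) = (\<Sum>y\<in>f ` topspace K. (c * y) *\<^sub>R \<mu> (fiber K f y))"
    using assms by (intro charge_integral_comp simple_continuous_simple_map) auto
  then show ?thesis by (simp add: charge_integral_def scaleR_sum_right)
qed

lemma charge_integral_diff:
  assumes "f \<in> simple_continuous K" "g \<in> simple_continuous K"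
  shows "charge_integral (f - g) = charge_integral f - charge_integral g"
  using charge_integral_add[OF simple_continuous_diff[OF assms] assms(2)]
  by (simp add: algebra_simps)

lemma charge_integral_indicator:
  assumes "U \<in> clopen_sets K"
  shows "charge_integral (indicator U) = \<mu> U"
proof -
  let ?h = "\<lambda>x. x \<in> U"
  have fib: "fiber K ?h b = (if b then U else topspace K - U)" for b
    using clopen_sets_subset[OF assms] by (auto simp: fiber_def)
  then have h: "simple_map K ?h"
    using assms by (auto simp: simple_map_def clopen_sets_Diff clopen_sets_topspace)
  have "charge_integral (indicator U) = (\<Sum>b\<in>?h ` topspace K. of_bool b *\<^sub>R \<mu> (fiber K ?h b))"
    by (rule charge_integral_comp[OF h]) (simp add: indicator_def)
  also have "\<dots> = (\<Sum>b\<in>UNIV. of_bool b *\<^sub>R \<mu> (fiber K ?h b))"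
  proof (rule sum.mono_neutral_left)
    show "\<forall>b\<in>UNIV - ?h ` topspace K. of_bool b *\<^sub>R \<mu> (fiber K ?h b) = 0"
    proof
      fix b assume "b \<in> UNIV - ?h ` topspace K"
      then have "fiber K ?h b = {}" by (auto simp: fiber_def)
      then show "of_bool b *\<^sub>R \<mu> (fiber K ?h b) = 0" by (simp add: charge_empty)
    qed
  qed auto
  also have "\<dots> = \<mu> U" by (simp add: UNIV_bool fib)
  finally show ?thesis .
qed

lemma charge_integral_mem: "f \<in> simple_continuous K \<Longrightarrow> charge_integral f \<in> G"
  unfolding charge_integral_def
  by (intro subspace_sum subspace_scale subspace charge_mem) (auto simp: simple_continuous_iff simple_map_def)

lemma charge_integral_nonneg:
  assumes "f \<in> simple_continuous K" "0 \<le> f"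
  shows "0 \<le> charge_integral f"
  unfolding charge_integral_def using assms
  by (intro sum_nonneg scaleR_nonneg_nonneg charge_nonneg)
    (auto simp: simple_continuous_iff simple_map_def le_fun_def)

lemma charge_integral_mono:
  assumes "f \<in> simple_continuous K" "g \<in> simple_continuous K" "f \<le> g"
  shows "charge_integral f \<le> charge_integral g"
  using charge_integral_nonneg[OF simple_continuous_diff[OF assms(2,1)]] assms
  by (simp add: charge_integral_diff)

text \<open>
  A nonnegative simple function is dominated by a multiple of the indicator of its support, and
  the supports of disjoint functions are disjoint clopen sets.  This carries disjointness over
  from charges of sets to integrals, for lower bounds \<open>w\<close> anywhere in \<open>G\<close>.
\<close>

lemma charge_integral_disjoint:
  assumes p: "p \<in> simple_continuous K" "0 \<le> p" and q: "q \<in> simple_continuous K" "0 \<le> q"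
    and disj: "inf p q = 0" and w: "w \<in> G" "w \<le> charge_integral p" "w \<le> charge_integral q"
  shows "w \<le> 0"
proof -
  define supp where "supp f = {x \<in> topspace K. f x \<noteq> 0}" for f :: "'k \<Rightarrow> real"
  obtain B where B: "B > 0" "\<And>x. \<bar>p x\<bar> \<le> B"
    using p by (auto elim: simple_continuous_bounded)
  obtain D where D: "D > 0" "\<And>x. \<bar>q x\<bar> \<le> D"
    using q by (auto elim: simple_continuous_bounded)
  define C where "C = max B D"
  have C: "C > 0" "\<And>x. \<bar>p x\<bar> \<le> C" "\<And>x. \<bar>q x\<bar> \<le> C"
    using B D by (auto simp: C_def le_max_iff_disj)
  have supp: "supp f \<in> clopen_sets K" if "f \<in> simple_continuous K" for f
    unfolding supp_def using that by (intro simple_map_preimage simple_continuous_simple_map)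
  have dom: "charge_integral f \<le> C *\<^sub>R \<mu> (supp f)"
    if f: "f \<in> simple_continuous K" "\<And>x. \<bar>f x\<bar> \<le> C" for f
  proof -
    have "f \<le> C *\<^sub>R indicator (supp f)"
    proof (rule le_funI)
      fix x
      show "f x \<le> (C *\<^sub>R indicator (supp f)) x"
        using f(1) f(2)[of x] C(1) by (auto simp: supp_def indicator_def simple_continuous_iff)
    qed
    then have "charge_integral f \<le> charge_integral (C *\<^sub>R indicator (supp f))"
      using f supp by (intro charge_integral_mono simple_continuous_scaleR simple_continuous_indicator)
    also have "\<dots> = C *\<^sub>R \<mu> (supp f)"
      using f supp by (simp add: charge_integral_scaleR charge_integral_indicator simple_continuous_indicator)
    finally show ?thesis .
  qed
  have "supp p \<inter> supp q = {}"
  proof -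
    have "min (p x) (q x) = 0" for x
      using fun_cong[OF disj, of x] by (simp add: inf_real_def)
    then show ?thesis by (auto simp: supp_def min_def) (metis+)
  qed
  then have "isGlb G {\<mu> (supp p), \<mu> (supp q)} 0"
    using p q by (intro charge_disjoint supp)
  moreover have scaled: "inverse C *\<^sub>R w \<le> v" if "w \<le> C *\<^sub>R v" for v
    using scaleR_left_mono[OF that, of "inverse C"] C(1) by simp
  have "inverse C *\<^sub>R w \<le> \<mu> (supp p)" "inverse C *\<^sub>R w \<le> \<mu> (supp q)"
    using dom[OF p(1) C(2)] dom[OF q(1) C(3)] w by (auto intro!: scaled intro: order_trans)
  moreover have "inverse C *\<^sub>R w \<in> G"
    using w subspace by (intro subspace_scale)
  ultimately have "inverse C *\<^sub>R w \<le> 0"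
    by (auto simp: isGlb_pair_iff)
  from scaleR_left_mono[OF this, of C] show ?thesis using C(1) by simp
qed

text \<open>
  If \<open>s = f \<squnion> g\<close>, then \<open>s - f\<close> and \<open>s - g\<close> are disjoint.  The integrals of these two functions
  dominate the defect \<open>\<integral>s - z\<close> of any upper bound \<open>z\<close>, which is therefore not positive.
\<close>

lemma isLub_charge_integral_sup:
  assumes f: "f \<in> simple_continuous K" and g: "g \<in> simple_continuous K"
  shows "isLub G {charge_integral f, charge_integral g} (charge_integral (sup f g))"
  unfolding isLub_pair_iff
proof (intro conjI ballI impI)
  let ?s = "sup f g"
  have s: "?s \<in> simple_continuous K" using f g by (rule simple_continuous_sup)
  show "charge_integral ?s \<in> G" using s by (rule charge_integral_mem)
  show "charge_integral f \<le> charge_integral ?s" "charge_integral g \<le> charge_integral ?s"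
    using f g s by (auto intro: charge_integral_mono)
  fix z assume z: "z \<in> G" "charge_integral f \<le> z" "charge_integral g \<le> z"
  have "charge_integral ?s - z \<le> 0"
  proof (rule charge_integral_disjoint)
    show "?s - f \<in> simple_continuous K" "?s - g \<in> simple_continuous K"
      using f g s by (auto intro: simple_continuous_diff)
    show "0 \<le> ?s - f" "0 \<le> ?s - g" by simp_all
    show "inf (?s - f) (?s - g) = 0"
      by (rule ext) (auto simp: inf_real_def sup_real_def min_def max_def)
    show "charge_integral ?s - z \<in> G"
      using subspace z s by (intro subspace_diff charge_integral_mem)
    show "charge_integral ?s - z \<le> charge_integral (?s - f)"
      "charge_integral ?s - z \<le> charge_integral (?s - g)"
      using z by (auto simp: charge_integral_diff f g s)
  qed
  then show "charge_integral ?s \<le> z" by simp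
qed

lemma isGlb_charge_integral_inf:
  assumes f: "f \<in> simple_continuous K" and g: "g \<in> simple_continuous K"
  shows "isGlb G {charge_integral f, charge_integral g} (charge_integral (inf f g))"
  unfolding isGlb_pair_iff
proof (intro conjI ballI impI)
  let ?i = "inf f g"
  have i: "?i \<in> simple_continuous K" using f g by (rule simple_continuous_inf)
  show "charge_integral ?i \<in> G" using i by (rule charge_integral_mem)
  show "charge_integral ?i \<le> charge_integral f" "charge_integral ?i \<le> charge_integral g"
    using f g i by (auto intro: charge_integral_mono)
  fix z assume z: "z \<in> G" "z \<le> charge_integral f" "z \<le> charge_integral g"
  have "z - charge_integral ?i \<le> 0"
  proof (rule charge_integral_disjoint)
    show "f - ?i \<in> simple_continuous K" "g - ?i \<in> simple_continuous K"
      using f g i by (auto intro: simple_continuous_diff)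
    show "0 \<le> f - ?i" "0 \<le> g - ?i" by simp_all
    show "inf (f - ?i) (g - ?i) = 0"
      by (rule ext) (auto simp: inf_real_def min_def)
    show "z - charge_integral ?i \<in> G"
      using subspace z i by (intro subspace_diff charge_integral_mem)
    show "z - charge_integral ?i \<le> charge_integral (f - ?i)"
      "z - charge_integral ?i \<le> charge_integral (g - ?i)"
      using z by (auto simp: charge_integral_diff f g i)
  qed
  then show "z \<le> charge_integral ?i" by simp
qed

lemma charge_integral_hom: "vector_lattice_hom_on (simple_continuous K) G charge_integral"
  unfolding vector_lattice_hom_on_def
proof (intro conjI ballI allI impI)
  fix f g s assume f: "f \<in> simple_continuous K" and g: "g \<in> simple_continuous K"
  show "isLub G {charge_integral f, charge_integral g} (charge_integral s)"
    if "isLub (simple_continuous K) {f, g} s"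
    using isLub_charge_integral_sup[OF f g] isLub_pair_unique[OF that isLub_simple_continuous_sup[OF f g]]
    by simp
  show "isGlb G {charge_integral f, charge_integral g} (charge_integral s)"
    if "isGlb (simple_continuous K) {f, g} s"
    using isGlb_charge_integral_inf[OF f g] isGlb_pair_unique[OF that isGlb_simple_continuous_inf[OF f g]]
    by simp
qed (simp_all add: charge_integral_mem charge_integral_add charge_integral_scaleR)

lemma charge_integral_image: "charge_integral ` simple_continuous K = span (\<mu> ` clopen_sets K)"
proof
  have "charge_integral f \<in> span (\<mu> ` clopen_sets K)" if "f \<in> simple_continuous K" for f
    using that unfolding charge_integral_def
    by (intro span_sum span_scale span_base) (auto simp: simple_continuous_iff simple_map_def)
  then show "charge_integral ` simple_continuous K \<subseteq> span (\<mu> ` clopen_sets K)"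
    by auto
  have "subspace (charge_integral ` simple_continuous K)"
    unfolding subspace_def
  proof (intro conjI ballI allI)
    have "charge_integral (indicator {}) = 0"
      by (simp add: charge_integral_indicator clopen_sets_empty charge_empty)
    then show "0 \<in> charge_integral ` simple_continuous K"
      by (metis clopen_sets_empty image_eqI simple_continuous_indicator)
  qed (auto simp: charge_integral_add[symmetric] charge_integral_scaleR[symmetric]
      intro: simple_continuous_add simple_continuous_scaleR)
  then show "span (\<mu> ` clopen_sets K) \<subseteq> charge_integral ` simple_continuous K"
    by (rule span_minimal[rotated])
      (auto simp: charge_integral_indicator[symmetric] simple_continuous_indicator)
qed

text \<open>
  By linearity and the lattice property, a nonzero kernel contains a nonzero \<open>f \<ge> 0\<close>.  It
  dominates a positive multiple of the indicator of a nonempty fibre, whose charge vanishes with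
  the integral of \<open>f\<close>; but an injective \<open>\<mu>\<close> vanishes on the empty set only.
\<close>

lemma inj_on_charge_integral_iff:
  "inj_on charge_integral (simple_continuous K) \<longleftrightarrow> inj_on \<mu> (clopen_sets K)"
proof
  assume inj: "inj_on charge_integral (simple_continuous K)"
  show "inj_on \<mu> (clopen_sets K)"
  proof (rule inj_onI)
    fix U V assume U: "U \<in> clopen_sets K" "V \<in> clopen_sets K" "\<mu> U = \<mu> V"
    then have "(indicator U :: 'k \<Rightarrow> real) = indicator V"
      by (intro inj_onD[OF inj]) (auto simp: charge_integral_indicator simple_continuous_indicator)
    then show "U = V" by (metis indicator_eq_1_iff subsetI subset_antisym)
  qed
next
  assume inj: "inj_on \<mu> (clopen_sets K)"
  have zero: "f x \<le> 0" if f: "f \<in> simple_continuous K" "charge_integral f = 0" for f x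
  proof (rule ccontr)
    assume pos: "\<not> f x \<le> 0"
    then have x: "x \<in> topspace K" using f(1) by (auto simp: simple_continuous_iff)
    have cz: "charge_integral 0 = 0"
      using charge_integral_scaleR[OF f(1), of 0] by simp
    have S0: "0 \<in> simple_continuous K"
      using subspace_simple_continuous by (rule subspace_0)
    have sup: "sup f 0 \<in> simple_continuous K"
      using f(1) S0 by (rule simple_continuous_sup)
    have le0: "charge_integral (sup f 0) \<le> 0"
      using isLub_charge_integral_sup[OF f(1) S0] subspace_0[OF subspace]
      unfolding isLub_pair_iff f(2) cz by blast
    let ?U = "fiber K f (f x)"
    have U: "?U \<in> clopen_sets K"
      using f(1) by (simp add: simple_continuous_iff simple_map_def)
    have "f x *\<^sub>R \<mu> ?U = charge_integral (f x *\<^sub>R indicator ?U)"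
      using U by (simp add: charge_integral_scaleR charge_integral_indicator simple_continuous_indicator)
    also have "\<dots> \<le> charge_integral (sup f 0)"
      using U sup by (intro charge_integral_mono simple_continuous_scaleR simple_continuous_indicator)
        (auto simp: le_fun_def indicator_def fiber_def sup_real_def)
    finally have le: "f x *\<^sub>R \<mu> ?U \<le> 0"
      using le0 by (rule order_trans)
    have "\<mu> ?U \<le> 0"
      using scaleR_left_mono[OF le, of "inverse (f x)"] pos by simp
    then have "\<mu> ?U = \<mu> {}"
      using charge_nonneg[OF U] by (simp add: charge_empty)
    then have "?U = {}"
      using inj U clopen_sets_empty by (auto dest: inj_onD)
    then show False using x by (auto simp: fiber_def)
  qed
  show "inj_on charge_integral (simple_continuous K)"
  proof (rule inj_onI)
    fix f g assume fg: "f \<in> simple_continuous K" "g \<in> simple_continuous K"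
      "charge_integral f = charge_integral g"
    have "(f - g) x \<le> 0" "(g - f) x \<le> 0" for x
      using fg by (auto intro!: zero simple_continuous_diff simp: charge_integral_diff simp del: minus_apply)
    then show "f = g" by (auto simp: fun_eq_iff intro: antisym)
  qed
qed

end

section \<open>The Stone space of a Boolean algebra\<close>

definition boolean_filter :: "'a::boolean_algebra set \<Rightarrow> bool" where
  "boolean_filter F \<longleftrightarrow> top \<in> F \<and> bot \<notin> F \<and> (\<forall>a b. inf a b \<in> F \<longleftrightarrow> a \<in> F \<and> b \<in> F)"

definition boolean_ultrafilter :: "'a::boolean_algebra set \<Rightarrow> bool" where
  "boolean_ultrafilter U \<longleftrightarrow> boolean_filter U \<and> (\<forall>a. a \<in> U \<or> - a \<in> U)"

lemma boolean_filter_mono: "boolean_filter F \<Longrightarrow> a \<in> F \<Longrightarrow> a \<le> b \<Longrightarrow> b \<in> F"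
  unfolding boolean_filter_def by (metis inf.absorb1)

lemma boolean_filter_principal: "a \<noteq> bot \<Longrightarrow> boolean_filter {x. a \<le> x}"
  by (auto simp: boolean_filter_def bot_unique)

text \<open>
  A maximal proper filter \<open>M\<close> decides every element: if \<open>a\<close> is compatible with all of \<open>M\<close>, then
  \<open>M\<close> and \<open>a\<close> generate a proper filter, which must be \<open>M\<close>; otherwise some member of \<open>M\<close> lies
  below \<open>- a\<close>.
\<close>

lemma boolean_ultrafilter_extends:
  fixes F :: "'a::boolean_algebra set"
  assumes "boolean_filter F"
  obtains U where "boolean_ultrafilter U" "F \<subseteq> U"
proof -
  let ?A = "{H. boolean_filter H \<and> F \<subseteq> H}"
  have "\<exists>M\<in>?A. \<forall>H\<in>?A. M \<subseteq> H \<longrightarrow> H = M"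
  proof (rule subset_Zorn_nonempty)
    show "?A \<noteq> {}" using assms by auto
    fix \<C> assume ne: "\<C> \<noteq> {}" and "subset.chain ?A \<C>"
    then have sub: "\<And>H. H \<in> \<C> \<Longrightarrow> boolean_filter H \<and> F \<subseteq> H"
      and lin: "\<And>H J. H \<in> \<C> \<Longrightarrow> J \<in> \<C> \<Longrightarrow> H \<subseteq> J \<or> J \<subseteq> H"
      by (auto simp: subset_chain_def)
    have "inf a b \<in> \<Union>\<C> \<longleftrightarrow> a \<in> \<Union>\<C> \<and> b \<in> \<Union>\<C>" for a b
    proof
      assume "inf a b \<in> \<Union>\<C>"
      then show "a \<in> \<Union>\<C> \<and> b \<in> \<Union>\<C>" using sub by (force simp: boolean_filter_def)
    next
      assume "a \<in> \<Union>\<C> \<and> b \<in> \<Union>\<C>"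
      then obtain H J where HJ: "H \<in> \<C>" "a \<in> H" "J \<in> \<C>" "b \<in> J" by auto
      then have "\<exists>L\<in>\<C>. a \<in> L \<and> b \<in> L" using lin[of H J] by blast
      then show "inf a b \<in> \<Union>\<C>" using sub by (force simp: boolean_filter_def)
    qed
    moreover have "top \<in> \<Union>\<C>" "bot \<notin> \<Union>\<C>" "F \<subseteq> \<Union>\<C>"
      using sub ne by (force simp: boolean_filter_def)+
    ultimately show "\<Union>\<C> \<in> ?A" by (simp add: boolean_filter_def)
  qed
  then obtain M where M: "boolean_filter M" "F \<subseteq> M"
    and max: "\<And>H. boolean_filter H \<Longrightarrow> M \<subseteq> H \<Longrightarrow> H = M"
    by (force intro: subset_trans)
  have "a \<in> M \<or> - a \<in> M" for a
  proof (cases "\<exists>m\<in>M. inf m a = bot")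
    case True
    then show ?thesis
      using M(1) boolean_filter_mono by (metis inf_shunt)
  next
    case False
    define H where "H = {x. \<exists>m\<in>M. inf m a \<le> x}"
    have top: "top \<in> M" using M(1) by (simp add: boolean_filter_def)
    have "boolean_filter H"
      unfolding boolean_filter_def
    proof (intro conjI allI)
      show "top \<in> H" using top by (auto simp: H_def)
      show "bot \<notin> H" using False by (auto simp: H_def bot_unique)
      fix x y
      have "\<exists>m\<in>M. inf m a \<le> inf x y" if "m \<in> M" "n \<in> M" "inf m a \<le> x" "inf n a \<le> y" for m n
      proof (rule bexI)
        show "inf m n \<in> M" using M(1) that by (simp add: boolean_filter_def)
        have "inf (inf m n) a = inf (inf m a) (inf n a)"
          by (simp add: inf.assoc inf.commute inf.left_commute)
        then show "inf (inf m n) a \<le> inf x y" using inf_mono[OF that(3,4)] by simp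
      qed
      then show "inf x y \<in> H \<longleftrightarrow> x \<in> H \<and> y \<in> H"
        by (auto simp: H_def)
    qed
    moreover have "M \<subseteq> H" by (auto simp: H_def intro: le_infI1)
    ultimately have "H = M" by (rule max)
    moreover have "a \<in> H" using top by (auto simp: H_def)
    ultimately show ?thesis by simp
  qed
  then show ?thesis using M by (intro that[of M]) (auto simp: boolean_ultrafilter_def)
qed

definition stone_set :: "'a::boolean_algebra \<Rightarrow> 'a set set" where
  "stone_set a = {U. boolean_ultrafilter U \<and> a \<in> U}"

lemma stone_set_top: "stone_set top = Collect boolean_ultrafilter"
  and stone_set_bot: "stone_set bot = {}"
  and stone_set_inf: "stone_set (inf a b) = stone_set a \<inter> stone_set b"
  by (auto simp: stone_set_def boolean_ultrafilter_def boolean_filter_def)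

lemma stone_set_uminus: "stone_set (- a) = Collect boolean_ultrafilter - stone_set a"
proof -
  have "\<not> (a \<in> U \<and> - a \<in> U)" if "boolean_ultrafilter U" for U
    using that unfolding boolean_ultrafilter_def boolean_filter_def
    by (metis inf_compl_bot)
  then show ?thesis by (auto simp: stone_set_def boolean_ultrafilter_def)
qed

lemma stone_set_subset: "stone_set a \<subseteq> Collect boolean_ultrafilter"
  by (auto simp: stone_set_def)

lemma stone_set_sup: "stone_set (sup a b) = stone_set a \<union> stone_set b"
proof -
  have "stone_set (sup a b) = stone_set (- inf (- a) (- b))" by simp
  also have "\<dots> = stone_set a \<union> stone_set b"
    unfolding stone_set_uminus stone_set_inf using stone_set_subset by blast
  finally show ?thesis .
qed

lemma stone_set_eq_empty: "stone_set a = {} \<Longrightarrow> a = bot"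
  by (rule ccontr, drule boolean_filter_principal, erule boolean_ultrafilter_extends)
    (auto simp: stone_set_def)

lemma stone_set_mono_iff: "stone_set a \<subseteq> stone_set b \<longleftrightarrow> a \<le> b"
proof
  assume "stone_set a \<subseteq> stone_set b"
  then have "stone_set (inf a (- b)) = {}"
    by (auto simp: stone_set_inf stone_set_uminus)
  then show "a \<le> b" by (metis stone_set_eq_empty double_compl inf_shunt)
next
  assume "a \<le> b"
  then show "stone_set a \<subseteq> stone_set b"
    by (metis inf.absorb1 inf_le2 stone_set_inf)
qed

lemma inj_stone_set: "inj stone_set"
  by (intro injI antisym; rule iffD1[OF stone_set_mono_iff]) simp_all

definition stone_space :: "'a::boolean_algebra set topology" where
  "stone_space = topology (\<lambda>V. V \<subseteq> Collect boolean_ultrafilter \<and>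
     (\<forall>U\<in>V. \<exists>a. U \<in> stone_set a \<and> stone_set a \<subseteq> V))"

lemma openin_stone_space:
  fixes V :: "'a::boolean_algebra set set"
  shows
  "openin stone_space V \<longleftrightarrow> V \<subseteq> Collect boolean_ultrafilter \<and>
     (\<forall>U\<in>V. \<exists>a. U \<in> stone_set a \<and> stone_set a \<subseteq> V)"
proof -
  define P where "P V \<longleftrightarrow> V \<subseteq> Collect boolean_ultrafilter \<and>
    (\<forall>U\<in>V. \<exists>a. U \<in> stone_set a \<and> stone_set a \<subseteq> V)" for V :: "'a set set"
  have "P (S \<inter> T)" if ST: "P S" "P T" for S T
    unfolding P_def
  proof (intro conjI ballI)
    show "S \<inter> T \<subseteq> Collect boolean_ultrafilter"
      using ST by (auto simp: P_def)
    fix U assume U: "U \<in> S \<inter> T"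
    obtain a where a: "U \<in> stone_set a" "stone_set a \<subseteq> S"
      using ST(1) U unfolding P_def by blast
    obtain b where b: "U \<in> stone_set b" "stone_set b \<subseteq> T"
      using ST(2) U unfolding P_def by blast
    from a b show "\<exists>a. U \<in> stone_set a \<and> stone_set a \<subseteq> S \<inter> T"
      by (intro exI[of _ "inf a b"]) (auto simp: stone_set_inf)
  qed
  moreover have "P (\<Union>\<K>)" if \<K>: "\<forall>S\<in>\<K>. P S" for \<K>
    unfolding P_def
  proof (intro conjI ballI)
    show "\<Union>\<K> \<subseteq> Collect boolean_ultrafilter"
      using \<K> unfolding P_def by blast
    fix U assume "U \<in> \<Union>\<K>"
    then obtain S where S: "S \<in> \<K>" "U \<in> S" by blast
    then obtain a where "U \<in> stone_set a" "stone_set a \<subseteq> S"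
      using \<K> unfolding P_def by blast
    with S show "\<exists>a. U \<in> stone_set a \<and> stone_set a \<subseteq> \<Union>\<K>" by blast
  qed
  ultimately have "istopology P"
    by (simp add: istopology_def)
  moreover have "(stone_space :: 'a set topology) = topology P"
    by (simp add: stone_space_def P_def[abs_def])
  ultimately have "openin stone_space V \<longleftrightarrow> P V"
    by (metis topology_inverse')
  then show ?thesis by (simp only: P_def)
qed

lemma openin_stone_set: "openin stone_space (stone_set a)"
  using stone_set_subset by (auto simp: openin_stone_space)

lemma topspace_stone_space: "topspace stone_space = Collect boolean_ultrafilter"
proof
  show "topspace stone_space \<subseteq> Collect boolean_ultrafilter"
    using openin_topspace[of stone_space] unfolding openin_stone_space by (rule conjunct1)
  show "Collect boolean_ultrafilter \<subseteq> topspace stone_space"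
    using openin_subset[OF openin_stone_set[of top]] by (simp only: stone_set_top)
qed

lemma stone_set_clopen: "stone_set a \<in> clopen_sets stone_space"
proof -
  have "topspace stone_space - stone_set a = stone_set (- a)"
    by (simp add: topspace_stone_space stone_set_uminus)
  then show ?thesis
    using stone_set_subset
    by (auto simp: clopen_sets_def closedin_def openin_stone_set topspace_stone_space)
qed

text \<open>
  Given an open cover, the elements \<open>a\<close> for which \<open>stone_set (- a)\<close> is finitely covered satisfy
  all filter axioms except possibly properness, and properness fails exactly if there is a finite
  subcover.  In the proper case, an ultrafilter extending them would be a point outside the cover.
\<close>

lemma compact_stone_space: "compact_space stone_space"
  unfolding compact_space_alt
proof (intro allI impI, elim conjE)
  fix \<U> :: "'a set set set"
  assume op: "\<forall>V\<in>\<U>. openin stone_space V" and cov: "topspace stone_space \<subseteq> \<Union>\<U>"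
  define F where "F = {a :: 'a. \<exists>\<V>. finite \<V> \<and> \<V> \<subseteq> \<U> \<and> stone_set (- a) \<subseteq> \<Union>\<V>}"
  show "\<exists>\<V>. finite \<V> \<and> \<V> \<subseteq> \<U> \<and> topspace stone_space \<subseteq> \<Union>\<V>"
  proof (rule ccontr)
    assume no: "\<not> ?thesis"
    have "boolean_filter F"
      unfolding boolean_filter_def
    proof (intro conjI allI iffI)
      show "top \<in> F" by (auto simp: F_def stone_set_bot)
      show "bot \<notin> F" using no by (auto simp: F_def stone_set_top topspace_stone_space)
      fix a b
      assume "inf a b \<in> F"
      then show "a \<in> F" "b \<in> F" by (auto simp: F_def stone_set_sup)
    next
      fix a b
      assume "a \<in> F \<and> b \<in> F"
      then obtain \<V> \<W> where "finite \<V>" "\<V> \<subseteq> \<U>" "stone_set (- a) \<subseteq> \<Union>\<V>"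
        "finite \<W>" "\<W> \<subseteq> \<U>" "stone_set (- b) \<subseteq> \<Union>\<W>" by (auto simp: F_def)
      then show "inf a b \<in> F"
        by (auto simp: F_def stone_set_sup intro!: exI[of _ "\<V> \<union> \<W>"])
    qed
    then obtain U where U: "boolean_ultrafilter U" "F \<subseteq> U"
      by (rule boolean_ultrafilter_extends)
    then obtain V where V: "V \<in> \<U>" "U \<in> V"
      using cov by (auto simp: topspace_stone_space)
    then obtain a where a: "U \<in> stone_set a" "stone_set a \<subseteq> V"
      using op unfolding openin_stone_space by blast
    have "- a \<in> F"
      using V a by (auto simp: F_def intro!: exI[of _ "{V}"])
    then have "U \<in> stone_set (- a)" using U by (auto simp: stone_set_def)
    with a(1) show False by (simp add: stone_set_uminus)
  qed
qed

lemma boolean_ultrafilter_separate: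
  assumes "boolean_ultrafilter U" "boolean_ultrafilter V" "U \<noteq> V"
  obtains a where "U \<in> stone_set a" "V \<in> stone_set (- a)"
proof -
  obtain b where "b \<in> U \<and> b \<notin> V \<or> b \<in> V \<and> b \<notin> U" using assms(3) by blast
  then have "U \<in> stone_set b \<and> V \<in> stone_set (- b) \<or> U \<in> stone_set (- b) \<and> V \<in> stone_set (- (- b))"
    using assms(1,2) by (auto simp: stone_set_def boolean_ultrafilter_def)
  then show ?thesis using that by blast
qed

lemma Hausdorff_stone_space: "Hausdorff_space stone_space"
  unfolding Hausdorff_space_def topspace_stone_space
proof (intro allI impI, elim conjE)
  fix U V :: "'a set"
  assume "U \<in> Collect boolean_ultrafilter" "V \<in> Collect boolean_ultrafilter" "U \<noteq> V"
  then obtain a where "U \<in> stone_set a" "V \<in> stone_set (- a)"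
    by (auto elim: boolean_ultrafilter_separate)
  moreover have "disjnt (stone_set a) (stone_set (- a))"
    by (auto simp: disjnt_def stone_set_uminus)
  ultimately show "\<exists>S T. openin stone_space S \<and> openin stone_space T \<and> U \<in> S \<and> V \<in> T \<and> disjnt S T"
    using openin_stone_set by blast
qed

lemma totally_disconnected_stone_space: "totally_disconnected_space stone_space"
  unfolding totally_disconnected_space_def
proof (intro allI impI)
  fix C :: "'a set set" assume C: "connectedin stone_space C"
  have "U = V" if UV: "U \<in> C" "V \<in> C" for U V
  proof (rule ccontr)
    assume "U \<noteq> V"
    moreover have "boolean_ultrafilter U" "boolean_ultrafilter V"
      using UV connectedin_subset_topspace[OF C] by (auto simp: topspace_stone_space)
    ultimately obtain a where a: "U \<in> stone_set a" "V \<in> stone_set (- a)"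
      by (auto elim: boolean_ultrafilter_separate)
    have "C \<subseteq> stone_set a \<or> disjnt C (stone_set a)"
      using C stone_set_clopen[of a] by (intro connectedin_clopen_cases) (auto simp: clopen_sets_def)
    then show False using a UV by (auto simp: stone_set_uminus disjnt_def)
  qed
  then show "C = {} \<or> (\<exists>x. C = {x})" by blast
qed

text \<open>
  A clopen set is compact and a union of sets \<open>stone_set a\<close>, hence a finite union of such sets,
  and these are closed under finite unions.
\<close>

lemma clopen_sets_stone_space:
  "clopen_sets (stone_space :: 'a::boolean_algebra set topology) = range stone_set"
proof
  show "range stone_set \<subseteq> clopen_sets (stone_space :: 'a set topology)"
    using stone_set_clopen by auto
  show "clopen_sets (stone_space :: 'a set topology) \<subseteq> range stone_set"
  proof
    fix V :: "'a set set" assume "V \<in> clopen_sets stone_space"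
    then have V: "openin stone_space V" "closedin stone_space V" by (auto simp: clopen_sets_def)
    have "compactin stone_space V"
      using compact_stone_space V(2) by (rule closedin_compact_space)
    moreover have "\<And>W. W \<in> {stone_set a | a. stone_set a \<subseteq> V} \<Longrightarrow> openin stone_space W"
      by (auto simp: openin_stone_set)
    moreover have "V \<subseteq> \<Union>{stone_set a | a. stone_set a \<subseteq> V}"
      using V(1) unfolding openin_stone_space by blast
    ultimately have "\<exists>\<F>. finite \<F> \<and> \<F> \<subseteq> {stone_set a | a. stone_set a \<subseteq> V} \<and> V \<subseteq> \<Union>\<F>"
      by (rule compactinD)
    then obtain \<F> where \<F>: "finite \<F>" "\<F> \<subseteq> {stone_set a | a. stone_set a \<subseteq> V}" "V \<subseteq> \<Union>\<F>"
      by blast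
    have "\<Union>\<F> \<in> range stone_set" if "finite \<F>" "\<F> \<subseteq> range stone_set" for \<F> :: "'a set set set"
      using that
    proof (induction \<F> rule: finite_induct)
      case empty
      show ?case using stone_set_bot by force
    next
      case (insert W \<F>)
      then obtain a b where "W = stone_set a" "\<Union>\<F> = stone_set b" by auto
      then show ?case by (auto simp: stone_set_sup[symmetric])
    qed
    moreover have "\<Union>\<F> = V" "\<F> \<subseteq> range stone_set" using \<F> by auto
    ultimately show "V \<in> range stone_set" using \<F>(1) by metis
  qed
qed

lemma isomorphic_to_clopen_algebra_stone_space:
  "isomorphic_to_clopen_algebra TYPE('a::boolean_algebra) (stone_space :: 'a set topology)"
  unfolding isomorphic_to_clopen_algebra_def
proof (intro exI[of _ stone_set] conjI allI)
  show "bij_betw stone_set UNIV (clopen_sets (stone_space :: 'a set topology))"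
    by (simp add: bij_betw_def inj_stone_set clopen_sets_stone_space)
qed (simp_all only: stone_set_bot stone_set_top stone_set_sup stone_set_inf stone_set_uminus
    topspace_stone_space)

section \<open>The vector lattice generated by a Boolean algebra\<close>

lemma generates_simple_continuous:
  "generates_vector_lattice (simple_continuous stone_space) (\<lambda>a::'a::boolean_algebra. indicator (stone_set a))"
  unfolding generates_vector_lattice_def
proof (intro conjI)
  let ?\<phi> = "\<lambda>a::'a. indicator (stone_set a) :: 'a set \<Rightarrow> real"
  let ?S = "simple_continuous (stone_space :: 'a set topology)"
  have mem: "?\<phi> a \<in> ?S" for a
    by (intro simple_continuous_indicator stone_set_clopen)
  show "inj ?\<phi>"
  proof (rule injI)
    fix a b assume "?\<phi> a = ?\<phi> b"
    then have "indicator (stone_set a) U = (indicator (stone_set b) U :: real)" for U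
      by (rule fun_cong)
    then have "stone_set a = stone_set b" by (auto simp: indicator_def of_bool_eq_iff)
    then show "a = b" by (rule injD[OF inj_stone_set])
  qed
  have "?\<phi> (sup a b) = sup (?\<phi> a) (?\<phi> b)" "?\<phi> (inf a b) = inf (?\<phi> a) (?\<phi> b)" for a b
    by (auto simp: fun_eq_iff stone_set_sup stone_set_inf indicator_def sup_real_def inf_real_def)
  then show "cone_lattice_hom ?S ?\<phi>"
    unfolding cone_lattice_hom_def
    using isLub_simple_continuous_sup[OF mem mem] isGlb_simple_continuous_inf[OF mem mem] mem
    by (auto simp: le_fun_def)
  show "?\<phi> bot = 0" by (auto simp: stone_set_bot)
  show "strong_unit_on ?S (?\<phi> top)"
    using strong_unit_simple_continuous[of "stone_space :: 'a set topology"]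
    by (simp only: stone_set_top topspace_stone_space)
  show "span (range ?\<phi>) = ?S"
    using span_clopen_indicators[of "stone_space :: 'a set topology"]
    by (simp add: clopen_sets_stone_space image_image)
qed

text \<open>
  Disjoint elements of the algebra have disjoint images, whose supremum is therefore their sum:
  this is why preserving the lattice operations already forces additivity.
\<close>

lemma disjoint_charge_of_cone_lattice_hom:
  fixes \<psi> :: "'a::boolean_algebra \<Rightarrow> 'v::ordered_real_vector"
  assumes "subspace G" "cone_lattice_hom G \<psi>" "\<psi> bot = 0"
  shows "disjoint_charge stone_space G (\<psi> \<circ> inv stone_set)"
proof -
  have inv: "inv stone_set (stone_set a) = a" for a :: 'a
    by (simp add: inj_stone_set)
  have mem: "\<psi> a \<in> G" "0 \<le> \<psi> a" for a
    using assms(2) by (auto simp: cone_lattice_hom_def)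
  have Glb: "isGlb G {\<psi> a, \<psi> b} 0" and add: "\<psi> (sup a b) = \<psi> a + \<psi> b"
    if "stone_set a \<inter> stone_set b = {}" for a b
  proof -
    have "inf a b = bot"
      by (rule stone_set_eq_empty) (simp add: stone_set_inf that)
    moreover have "isGlb G {\<psi> a, \<psi> b} (\<psi> (inf a b))"
      using assms(2) by (simp add: cone_lattice_hom_def)
    ultimately show Glb: "isGlb G {\<psi> a, \<psi> b} 0"
      using assms(3) by simp
    have "isLub G {\<psi> a, \<psi> b} (\<psi> (sup a b))"
      using assms(2) by (simp add: cone_lattice_hom_def)
    with Glb show "\<psi> (sup a b) = \<psi> a + \<psi> b"
      by (intro isLub_eq_add_of_disjoint[OF assms(1) mem(1) mem(1)])
  qed
  show ?thesis
    by unfold_locales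
      (auto simp: clopen_sets_stone_space inv mem Glb add stone_set_sup[symmetric] assms(1))
qed

text \<open>
  The universal property for the simple functions on the Stone space.  The homomorphism property
  of \<open>\<psi>\<close> passes from \<open>H\<close> to the span of its image, since a supremum in a larger space that lies
  in a subspace is also a supremum there.  The converse fails in general, so the conclusion is
  about the span and not about \<open>H\<close>.
\<close>

lemma simple_function_extension:
  fixes \<psi> :: "'a::boolean_algebra \<Rightarrow> 'v::ordered_real_vector"
  assumes "cone_lattice_hom H \<psi>" "\<psi> bot = 0" "span (range \<psi>) \<subseteq> H"
  shows "\<exists>T. vector_lattice_hom_on (simple_continuous stone_space) (span (range \<psi>)) T \<and>
    T ` simple_continuous stone_space = span (range \<psi>) \<and>
    (\<forall>a. T (indicator (stone_set a)) = \<psi> a) \<and>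
    (inj_on T (simple_continuous stone_space) \<longleftrightarrow> inj \<psi>)"
proof -
  let ?G = "span (range \<psi>)" and ?\<mu> = "\<psi> \<circ> inv stone_set"
  have inv: "inv stone_set (stone_set a) = a" for a :: 'a
    by (simp add: inj_stone_set)
  have "\<psi> a \<in> ?G" for a by (simp add: span_base)
  then have "cone_lattice_hom ?G \<psi>"
    using assms(1) isLub_pair_subset[OF _ assms(3)] isGlb_pair_subset[OF _ assms(3)]
    unfolding cone_lattice_hom_def by blast
  then interpret disjoint_charge stone_space ?G ?\<mu>
    using assms(2) by (intro disjoint_charge_of_cone_lattice_hom) auto
  have "?\<mu> ` clopen_sets stone_space = range \<psi>"
    by (simp add: clopen_sets_stone_space image_image inv)
  moreover have "inj_on ?\<mu> (clopen_sets stone_space) \<longleftrightarrow> inj \<psi>"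
    by (simp add: clopen_sets_stone_space inj_on_def inv inj_eq[OF inj_stone_set])
  moreover have "charge_integral (indicator (stone_set a)) = \<psi> a" for a
    by (simp add: charge_integral_indicator stone_set_clopen inv)
  ultimately show ?thesis
    using charge_integral_hom charge_integral_image inj_on_charge_integral_iff by auto
qed

text \<open>
  The simple functions on the Stone space act as an intermediary: both \<open>\<phi>\<close> and \<open>\<psi>\<close> extend to
  them, the extension of \<open>\<phi>\<close> is bijective because \<open>\<phi>\<close> is injective and spans \<open>E\<close>, and \<open>J\<close>
  is its inverse followed by the extension of \<open>\<psi>\<close>.
\<close>

lemma generated_vector_lattice_universal:
  fixes \<phi> :: "'a::boolean_algebra \<Rightarrow> 'e::ordered_real_vector"
    and \<psi> :: "'a \<Rightarrow> 'f::ordered_real_vector"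
  assumes gen: "generates_vector_lattice E \<phi>" and \<psi>: "cone_lattice_hom UNIV \<psi>" "\<psi> bot = 0"
  shows "vector_lattice_on (span (range \<psi>)) \<and>
    (\<exists>J. vector_lattice_hom_on E (span (range \<psi>)) J \<and> J ` E = span (range \<psi>) \<and>
      \<psi> = J \<circ> \<phi> \<and> (inj_on J E \<longleftrightarrow> inj \<psi>))"
proof -
  let ?S = "simple_continuous (stone_space :: 'a set topology)" and ?G = "span (range \<psi>)"
  have \<phi>: "inj \<phi>" "cone_lattice_hom E \<phi>" "\<phi> bot = 0" "span (range \<phi>) = E"
    using gen by (auto simp: generates_vector_lattice_def)
  obtain T where T: "vector_lattice_hom_on ?S E T" "T ` ?S = E" "inj_on T ?S"
    and T_ind: "\<And>a. T (indicator (stone_set a)) = \<phi> a"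
    using simple_function_extension[OF \<phi>(2,3)] \<phi>(1,4) by auto
  obtain R where R: "vector_lattice_hom_on ?S ?G R" "R ` ?S = ?G" "inj_on R ?S \<longleftrightarrow> inj \<psi>"
    and R_ind: "\<And>a. R (indicator (stone_set a)) = \<psi> a"
    using simple_function_extension[OF \<psi> subset_UNIV] by auto
  have bij: "bij_betw T ?S E" using T by (simp add: bij_betw_def)
  define J where "J = R \<circ> the_inv_into ?S T"
  have JT: "J (T f) = R f" if "f \<in> ?S" for f
    using that T(3) by (simp add: J_def the_inv_into_f_f)
  have "vector_lattice_hom_on E ?G J"
    unfolding J_def
    by (rule vector_lattice_hom_on_comp[OF
          vector_lattice_hom_on_inverse[OF vector_lattice_simple_continuous T(1) bij] R(1)])
  moreover have "J ` E = ?G"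
    unfolding T(2)[symmetric] R(2)[symmetric] image_image by (rule image_cong) (auto simp: JT)
  moreover have "\<psi> = J \<circ> \<phi>"
  proof
    fix a
    have "(indicator (stone_set a) :: 'a set \<Rightarrow> real) \<in> ?S"
      by (intro simple_continuous_indicator stone_set_clopen)
    then show "\<psi> a = (J \<circ> \<phi>) a" using JT[of "indicator (stone_set a)"] by (simp add: T_ind R_ind)
  qed
  moreover have "inj_on J E \<longleftrightarrow> inj_on R ?S"
  proof -
    have "inj_on J E \<longleftrightarrow> inj_on (J \<circ> T) ?S"
      using T(2,3) comp_inj_on_iff[OF T(3), of J] by simp
    also have "\<dots> \<longleftrightarrow> inj_on R ?S"
      by (rule inj_on_cong) (simp add: JT)
    finally show ?thesis .
  qed
  moreover have "vector_lattice_on ?G"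
    using vector_lattice_simple_continuous R(1,2) by (rule vector_lattice_hom_on_image) simp
  ultimately show ?thesis using R(3) by blast
qed

theorem theorem3p2:
  shows
    "(\<exists>(E :: ('a::boolean_algebra set \<Rightarrow> real) set) (\<phi> :: 'a \<Rightarrow> 'a set \<Rightarrow> real).
        vector_lattice_on E \<and> ppp_on E \<and> generates_vector_lattice E \<phi> \<and>
        (\<exists>K :: 'a set topology.
           compact_space K \<and> Hausdorff_space K \<and> totally_disconnected_space K \<and>
           isomorphic_to_clopen_algebra TYPE('a) K \<and>
           vector_lattice_isomorphic E (simple_continuous K))) \<and>
     (\<forall>(E :: ('a set \<Rightarrow> real) set) (\<phi> :: 'a \<Rightarrow> 'a set \<Rightarrow> real).
        vector_lattice_on E \<and> ppp_on E \<and> generates_vector_lattice E \<phi> \<longrightarrow>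
        (\<forall>\<psi> :: 'a \<Rightarrow> 'f::ordered_real_vector.
           cone_lattice_hom UNIV \<psi> \<and> \<psi> bot = 0 \<longrightarrow>
           vector_lattice_on (span (range \<psi>)) \<and>
           (\<exists>J. vector_lattice_hom_on E (span (range \<psi>)) J \<and>
                J ` E = span (range \<psi>) \<and>
                \<psi> = J \<circ> \<phi> \<and>
                (inj_on J E \<longleftrightarrow> inj \<psi>))))"
proof (intro conjI allI impI)
  let ?K = "stone_space :: 'a set topology"
  have isomorphic: "vector_lattice_isomorphic (simple_continuous ?K) (simple_continuous ?K)"
    unfolding vector_lattice_isomorphic_def using vector_lattice_hom_on_id bij_betw_id by blast
  show "\<exists>(E :: ('a set \<Rightarrow> real) set) (\<phi> :: 'a \<Rightarrow> 'a set \<Rightarrow> real).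
      vector_lattice_on E \<and> ppp_on E \<and> generates_vector_lattice E \<phi> \<and>
      (\<exists>K :: 'a set topology.
         compact_space K \<and> Hausdorff_space K \<and> totally_disconnected_space K \<and>
         isomorphic_to_clopen_algebra TYPE('a) K \<and>
         vector_lattice_isomorphic E (simple_continuous K))"
    by (rule exI[of _ "simple_continuous ?K"], rule exI[of _ "\<lambda>a. indicator (stone_set a)"],
        intro conjI exI[of _ ?K] vector_lattice_simple_continuous ppp_simple_continuous
          generates_simple_continuous compact_stone_space Hausdorff_stone_space
          totally_disconnected_stone_space isomorphic_to_clopen_algebra_stone_space
          isomorphic)
next
  fix E :: "('a set \<Rightarrow> real) set" and \<phi> :: "'a \<Rightarrow> 'a set \<Rightarrow> real" and \<psi> :: "'a \<Rightarrow> 'f"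
  assume "vector_lattice_on E \<and> ppp_on E \<and> generates_vector_lattice E \<phi>"
    and "cone_lattice_hom UNIV \<psi> \<and> \<psi> bot = 0"
  then have *: "vector_lattice_on (span (range \<psi>)) \<and>
      (\<exists>J. vector_lattice_hom_on E (span (range \<psi>)) J \<and> J ` E = span (range \<psi>) \<and>
        \<psi> = J \<circ> \<phi> \<and> (inj_on J E \<longleftrightarrow> inj \<psi>))"
    by (intro generated_vector_lattice_universal) simp_all
  from * show "vector_lattice_on (span (range \<psi>))" by (rule conjunct1)
  from * show "\<exists>J. vector_lattice_hom_on E (span (range \<psi>)) J \<and> J ` E = span (range \<psi>) \<and>
      \<psi> = J \<circ> \<phi> \<and> (inj_on J E \<longleftrightarrow> inj \<psi>)" by (rule conjunct2)
qed

end
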